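(* Let $G$ be a non-bipartite connected graph on $n$ vertices. Then $$\eta^*(G)\ge \frac{n^2}{4}+n,$$ unless $G$ is obtained from a tree by expanding a single vertex into $C_3$.
   Context: All graphs are finite and simple. $C_3$ is the triangle. A graph is obtained from a tree by expanding a single vertex into $C_3$ if it arises from a tree by replacing one vertex $v$ with a triangle, each edge formerly incident with $v$ becoming incident with exactly one (arbitrarily chosen) vertex of the triangle; equivalently, it is a connected graph whose only cycle is a triangle (a triangle with a possibly trivial tree rooted at each of its vertices). For a connected graph $G=(V,E)$ on $n$ vertices, $d(a,b)$ is the length of a shortest path between $a$ and $b$, and $W(G)=\sum_{\{a,b\}\subseteq V} d(a,b)$ is the Wiener index (sum over unordered pairs of vertices). For an edge $uv$, $n_{uv}(u)$ is the number of vertices strictly closer to $u$ than to $v$, $n_{uv}(v)$ is the number of vertices strictly closer to $v$ than to $u$, and $n_0(u,v)=n-n_{uv}(u)-n_{uv}(v)$. The revised Szeged index is $$\mathrm{Sz}^*(G)=\sum_{uv\in E}\Big(n_{uv}(u)+\frac{n_0(u,v)}{2}\Big)\Big(n_{uv}(v)+\frac{n_0(u,v)}{2}\Big),$$ and $\eta^*(G)=\mathrm{Sz}^*(G)-W(G)$. *)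

theory Defs
  imports Complex_Main "Graph_Theory.Graph_Theory"
begin

text \<open>
  A finite simple graph is a \<^locale>\<open>pair_graph\<close>: finite vertex set and a symmetric,
  loop-free set of arcs, so that an undirected edge \<open>uv\<close> is the pair of arcs
  \<open>(u, v)\<close>, \<open>(v, u)\<close>.
\<close>

definition bipartite :: "'a pair_pre_digraph \<Rightarrow> bool" where
  "bipartite G \<longleftrightarrow>
     (\<exists>X Y. pverts G = X \<union> Y \<and> X \<inter> Y = {} \<and> parcs G \<subseteq> X \<times> Y \<union> Y \<times> X)"

text \<open>Only meaningful if \<open>a\<close> and \<open>b\<close> are connected by a path.\<close>

definition gdist :: "'a pair_pre_digraph \<Rightarrow> 'a \<Rightarrow> 'a \<Rightarrow> nat" where
  "gdist G a b = (LEAST k. \<exists>p. pre_digraph.apath (with_proj G) a p b \<and> length p = k)"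

text \<open>
  The factor 1/2 turns the sum over ordered pairs into one over unordered pairs: the
  summand is symmetric, and the diagonal contributes 0.
\<close>

definition wiener :: "'a pair_pre_digraph \<Rightarrow> real" where
  "wiener G = (\<Sum>a\<in>pverts G. \<Sum>b\<in>pverts G. real (gdist G a b)) / 2"

text \<open>\<open>closer G u v\<close> is $n_{uv}(u)$ and \<open>equidist G u v\<close> is $n_0(u,v)$.\<close>

definition closer :: "'a pair_pre_digraph \<Rightarrow> 'a \<Rightarrow> 'a \<Rightarrow> nat" where
  "closer G u v = card {w \<in> pverts G. gdist G w u < gdist G w v}"

definition equidist :: "'a pair_pre_digraph \<Rightarrow> 'a \<Rightarrow> 'a \<Rightarrow> real" where
  "equidist G u v = real (card (pverts G)) - real (closer G u v) - real (closer G v u)"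

text \<open>The summand is symmetric and every edge \<open>uv\<close> occurs as two arcs, hence the factor 1/2.\<close>

definition revised_szeged :: "'a pair_pre_digraph \<Rightarrow> real" where
  "revised_szeged G =
     (\<Sum>(u, v)\<in>parcs G.
        (real (closer G u v) + equidist G u v / 2) *
        (real (closer G v u) + equidist G u v / 2)) / 2"

definition eta_star :: "'a pair_pre_digraph \<Rightarrow> real" where
  "eta_star G = revised_szeged G - wiener G"

text \<open>
  The constant \<^const>\<open>tree\<close> of the library cannot be used here: in a symmetric digraph
  the two arcs of an edge form a cycle of length 2. Cycles of length at least 3 are
  exactly the cycles of the undirected graph.
\<close>

definition undirected_tree :: "'a pair_pre_digraph \<Rightarrow> bool" where
  "undirected_tree T \<longleftrightarrow>
     pair_graph T \<and> Digraph_Component.connected (with_proj T) \<and>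
     \<not> (\<exists>p. pre_digraph.cycle (with_proj T) p \<and> 3 \<le> length p)"

text \<open>
  \<open>G\<close> arises from \<open>T\<close> by replacing the vertex \<open>v\<close> with a triangle \<open>a b c\<close>; the edge
  from \<open>x\<close> to \<open>v\<close> becomes the edge from \<open>x\<close> to \<open>f x\<close>. The new vertices may
  include \<open>v\<close> itself.
\<close>

definition triangle_expansion ::
  "'a pair_pre_digraph \<Rightarrow> 'a \<Rightarrow> 'a pair_pre_digraph \<Rightarrow> bool" where
  "triangle_expansion T v G \<longleftrightarrow>
     (\<exists>a b c f.
        distinct [a, b, c] \<and> {a, b, c} \<inter> (pverts T - {v}) = {} \<and>
        (\<forall>x. (x, v) \<in> parcs T \<longrightarrow> f x \<in> {a, b, c}) \<and>
        pverts G = (pverts T - {v}) \<union> {a, b, c} \<and>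
        parcs G =
          {(x, y). (x, y) \<in> parcs T \<and> x \<noteq> v \<and> y \<noteq> v} \<union>
          {(x, y). x \<in> {a, b, c} \<and> y \<in> {a, b, c} \<and> x \<noteq> y} \<union>
          {(x, f x) | x. (x, v) \<in> parcs T} \<union>
          {(f x, x) | x. (x, v) \<in> parcs T})"

text \<open>
  Taking \<open>T\<close> over the same vertex type as \<open>G\<close> loses nothing: \<open>v\<close> can be chosen as
  a vertex of the triangle.
\<close>

definition tree_expanded_by_triangle :: "'a pair_pre_digraph \<Rightarrow> bool" where
  "tree_expanded_by_triangle G \<longleftrightarrow>
     (\<exists>T v. undirected_tree T \<and> v \<in> pverts T \<and> triangle_expansion T v G)"

end

theory Submission
  imports Defs
begin

text \<open>
  Let $t(e)$ be the number of vertices equidistant from the ends of the edge $e$. Counting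
  pairs of vertices separated by edges gives
  $\eta^*(G) = \sum_{\{a,b\}} (s(a,b) - d(a,b)) + \frac14 \sum_e t(e)(2n - t(e))$,
  where $s(a,b)$ is the number of edges separating $a$ and $b$, and $s(a,b) \ge d(a,b)$ because
  the edges of a shortest path separate its ends.

  Since $G$ is not bipartite, every vertex is equidistant from the ends of some edge, so
  $\sum_e t(e) \ge n$. If $G$ is triangle-free, then $t(e) \le n - 4$ whenever $t(e) > 0$, and
  the bound follows from $2n - t(e) \ge n + 4$.

  The edges of a triangle alone give $\sum_e t(e)(2n - t(e)) \ge n^2 + 4n - 6$. The missing 6 is
  supplied by any further edge with $t(e) > 0$, which contributes at least $2n - 1 \ge 7$, and
  also by any two vertices joined by two shortest paths, for which $s - d \ge 2$. If neither
  exists, every vertex has a unique parent in the breadth-first search from a vertex of the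
  triangle, so contracting the triangle leaves a tree.
\<close>

section \<open>Cycles and level functions\<close>

lemma pcas_consecutive:
  "pcas u p v \<Longrightarrow> Suc i < length p \<Longrightarrow> snd (p ! i) = fst (p ! Suc i)"
proof (induction p arbitrary: u i)
  case (Cons e p)
  then show ?case
    by (cases i; cases p) auto
qed simp

lemma pcas_verts: "pcas u p v \<Longrightarrow> tl (pawalk_verts u p) = map snd p"
proof (induction p arbitrary: u)
  case (Cons e p)
  then show ?case
    by (cases p) auto
qed simp

lemma pcas_last: "pcas u p v \<Longrightarrow> p \<noteq> [] \<Longrightarrow> snd (last p) = v"
  by (induction p arbitrary: u) auto

text \<open>At a vertex \<open>y\<close> of the cycle where \<open>h\<close> is maximal, both cyclic
  neighbours have \<open>h\<close> at most \<open>h y\<close>, so \<open>lower\<close> identifies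
  them; as the vertices are distinct, this forces fewer than 3 arcs. Later \<open>h\<close> is the
  breadth-first level.\<close>

lemma cycle_length_less_3:
  fixes h :: "'a \<Rightarrow> nat"
  assumes lower: "\<And>x y z. (x, y) \<in> parcs T \<Longrightarrow> (y, z) \<in> parcs T \<Longrightarrow> h x \<le> h y \<Longrightarrow> h z \<le> h y \<Longrightarrow> x = z"
    and cyc: "pre_digraph.cycle (with_proj T) p"
  shows "length p < 3"
proof (rule ccontr)
  assume L: "\<not> length p < 3"
  obtain u where arcs: "set p \<subseteq> parcs T" and cas: "pcas u p u"
    and dist: "distinct (tl (pawalk_verts u p))"
    using cyc unfolding pre_digraph.cycle_def pre_digraph.awalk_def
    by (auto simp: cas_with_proj_eq awalk_verts_with_proj_eq)
  \<comment> \<open>A closed walk repeats its start vertex, so only the tail of its vertex list is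
    distinct. That tail lists the heads of the arcs, which index the vertices from here on.\<close>
  have dist: "distinct (map snd p)"
    using dist pcas_verts[OF cas] by simp
  have next_arc: "snd (p ! i) = fst (p ! (Suc i mod length p))" if "i < length p" for i
  proof (cases "Suc i = length p")
    case True
    have "p \<noteq> []"
      using that by auto
    moreover from this have "p ! i = last p"
      using True by (simp add: last_conv_nth flip: True)
    moreover from \<open>p \<noteq> []\<close> cas have "fst (p ! 0) = u"
      by (cases p) auto
    ultimately show ?thesis
      using pcas_last[OF cas] True by simp
  next
    case False
    then show ?thesis
      using pcas_consecutive[OF cas] that by simp
  qed
  define m where "m = Max (h ` snd ` set p)"
  have "m \<in> h ` snd ` set p"
    unfolding m_def using L by (intro Max_in) auto
  then obtain i where i: "i < length p" "h (snd (p ! i)) = m"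
    by (auto simp: in_set_conv_nth)
  have max: "h (snd (p ! j)) \<le> h (snd (p ! i))" if "j < length p" for j
    unfolding i m_def using that by (intro Max_ge) auto
  \<comment> \<open>\<open>k\<close> and \<open>j\<close> are the cyclic predecessor and successor
    of \<open>i\<close>; the case distinction avoids truncated subtraction at
    \<open>i = 0\<close>.\<close>
  define k where "k = (if i = 0 then length p - 1 else i - 1)"
  define j where "j = Suc i mod length p"
  have k: "k < length p" "Suc k mod length p = i"
    using i L by (auto simp: k_def)
  have j: "j < length p"
    unfolding j_def using i(1) by (intro mod_less_divisor) auto
  have "p ! i = (snd (p ! k), snd (p ! i))"
    using next_arc[OF k(1)] k(2) by (simp add: prod_eq_iff)
  then have "(snd (p ! k), snd (p ! i)) \<in> parcs T"
    using arcs nth_mem[OF i(1)] by auto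
  moreover have "p ! j = (snd (p ! i), snd (p ! j))"
    using next_arc[OF i(1)] by (simp add: prod_eq_iff j_def)
  then have "(snd (p ! i), snd (p ! j)) \<in> parcs T"
    using arcs nth_mem[OF j] by auto
  ultimately have "snd (p ! k) = snd (p ! j)"
    using lower max k(1) j by blast
  then have "k = j"
    using dist k(1) j by (simp add: distinct_conv_nth) metis
  \<comment> \<open>\<open>k = j\<close> says that \<open>i - 1\<close> and \<open>i + 1\<close>
    agree modulo \<open>length p\<close>, so \<open>length p\<close> would divide 2.\<close>
  then show False
    using L i(1) unfolding j_def k_def
    by (cases "Suc i = length p") (auto split: if_splits)
qed

section \<open>Distances in connected graphs\<close>

lemma length_rev_path: "length (rev_path p) = length p"
  by (induction p) auto

locale connected_pair_graph = pair_graph +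
  assumes connected_graph: "Digraph_Component.connected (with_proj G)"
begin

abbreviation d :: "'a \<Rightarrow> 'a \<Rightarrow> nat" where
  "d \<equiv> gdist G"

lemma arc_sym: "(u, v) \<in> parcs G \<Longrightarrow> (v, u) \<in> parcs G"
  using arcs_symmetric by blast

lemma arc_neq: "(u, v) \<in> parcs G \<Longrightarrow> u \<noteq> v"
  using pair_no_loops by fastforce

lemma ex_awalk:
  assumes "a \<in> pverts G" "b \<in> pverts G"
  shows "\<exists>p. awalk a p b"
proof -
  have "a \<rightarrow>\<^sup>*\<^bsub>mk_symmetric (with_proj G)\<^esub> b"
    using connected_graph assms
    unfolding Digraph_Component.connected_def strongly_connected_def by simp
  then have "a \<rightarrow>\<^sup>*\<^bsub>with_proj G\<^esub> b"
    using reachable_mk_symmetric_eq pair_sym_arcs by blast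
  then show ?thesis
    using reachable_awalk by blast
qed

text \<open>\<open>gdist\<close> minimises over paths, so the walk is first shortened to a path. The
  arcs of this path are distinct and occur in the walk, hence it is no longer than the walk.\<close>

lemma gdist_le_length:
  assumes "awalk a p b"
  shows "d a b \<le> length p"
proof -
  let ?q = "awalk_to_apath p"
  have q: "apath a ?q b"
    using assms by (rule apath_awalk_to_apath)
  then have "distinct ?q"
    unfolding apath_def using distinct_verts_imp_distinct by blast
  then have "length ?q = card (set ?q)"
    by (simp add: distinct_card)
  also have "\<dots> \<le> card (set p)"
    using awalk_to_apath_subset[OF assms] by (intro card_mono) auto
  also have "\<dots> \<le> length p"
    by (rule card_length)
  finally have "length ?q \<le> length p" .
  moreover have "d a b \<le> length ?q"
    unfolding gdist_def using q by (intro Least_le) blast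
  ultimately show ?thesis by simp
qed

lemma shortest_awalk:
  assumes "a \<in> pverts G" "b \<in> pverts G"
  obtains p where "awalk a p b" "length p = d a b"
proof -
  obtain q where "awalk a q b"
    using ex_awalk assms by blast
  then have "apath a (awalk_to_apath q) b"
    by (rule apath_awalk_to_apath)
  then have "\<exists>k p. apath a p b \<and> length p = k" by blast
  then have "\<exists>p. apath a p b \<and> length p = d a b"
    unfolding gdist_def by (rule LeastI_ex)
  then show thesis
    using that awalkI_apath by blast
qed

lemma gdist_self [simp]: "a \<in> pverts G \<Longrightarrow> d a a = 0"
  using gdist_le_length[of a "[]" a] by (simp add: awalk_Nil_iff)

lemma gdist_eq_0_iff:
  assumes "a \<in> pverts G" "b \<in> pverts G"
  shows "d a b = 0 \<longleftrightarrow> a = b"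
proof
  assume "d a b = 0"
  then obtain p where "awalk a p b" "length p = 0"
    using shortest_awalk[OF assms] by metis
  then show "a = b" by (simp add: awalk_Nil_iff)
qed (use assms in simp)

lemma gdist_triangle:
  assumes "a \<in> pverts G" "b \<in> pverts G" "c \<in> pverts G"
  shows "d a c \<le> d a b + d b c"
proof -
  obtain p q where "awalk a p b" "length p = d a b" "awalk b q c" "length q = d b c"
    using shortest_awalk assms by metis
  then show ?thesis
    using gdist_le_length[of a "p @ q" c] awalk_appendI by fastforce
qed

lemma gdist_sym:
  assumes "a \<in> pverts G" "b \<in> pverts G"
  shows "d a b = d b a"
proof -
  have "d y x \<le> d x y" if "x \<in> pverts G" "y \<in> pverts G" for x y
  proof -
    obtain p where "awalk x p y" "length p = d x y"
      using shortest_awalk \<open>x \<in> pverts G\<close> \<open>y \<in> pverts G\<close> by blast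
    then have "awalk y (rev_path p) x" "length (rev_path p) = d x y"
      by (simp_all add: length_rev_path)
    then show ?thesis
      using gdist_le_length by metis
  qed
  then show ?thesis
    using assms by (simp add: le_antisym)
qed

lemma gdist_arc:
  assumes "(u, v) \<in> parcs G"
  shows "d u v = 1"
proof -
  have V: "u \<in> pverts G" "v \<in> pverts G"
    using assms wellformed' by auto
  have "awalk u [(u, v)] v"
    using assms V by (simp add: awalk_simps)
  then have "d u v \<le> 1"
    using gdist_le_length[of u "[(u, v)]" v] by simp
  moreover have "d u v \<noteq> 0"
    using gdist_eq_0_iff V arc_neq assms by blast
  ultimately show ?thesis by simp
qed

lemma gdist_arc_le:
  assumes "(u, v) \<in> parcs G" "w \<in> pverts G"
  shows "d w v \<le> Suc (d w u)"
  using gdist_triangle[of w u v] gdist_arc[OF assms(1)] wellformed'[OF assms(1)] assms(2) by simp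

lemma pred_exists:
  assumes "a \<in> pverts G" "b \<in> pverts G" "d a b = Suc k"
  obtains c where "(c, b) \<in> parcs G" "d a c = k"
proof -
  obtain p where p: "awalk a p b" "length p = Suc k"
    using shortest_awalk assms by metis
  then obtain q e where pq: "p = q @ [e]"
    by (cases p rule: rev_cases) auto
  then obtain c where c: "awalk a q c" "awalk c [e] b"
    using p by (meson awalk_append_iff)
  then have e: "(c, b) \<in> parcs G"
    by (cases e) (auto simp: awalk_simps)
  have "d a c \<le> k"
    using gdist_le_length[OF c(1)] p pq by simp
  moreover have "Suc k \<le> Suc (d a c)"
    using gdist_arc_le[OF e assms(1)] assms(3) by simp
  ultimately show thesis
    using that e by simp
qed

lemma arc_if_gdist_1:
  assumes "u \<in> pverts G" "v \<in> pverts G" "d u v = 1"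
  shows "(u, v) \<in> parcs G"
proof -
  obtain c where "(c, v) \<in> parcs G" "d u c = 0"
    using pred_exists[of u v 0] assms by auto
  moreover from this have "u = c"
    using gdist_eq_0_iff assms wellformed' by blast
  ultimately show ?thesis by simp
qed

text \<open>A shortest path climbs one level at a time. The last conjunct, written without
  subtraction, says that \<open>(u, v)\<close> lies on a shortest path from \<open>s\<close> to
  \<open>t\<close>.\<close>

lemma arc_at_level:
  assumes "s \<in> pverts G" "t \<in> pverts G" "i < d s t"
  shows "\<exists>u v. (u, v) \<in> parcs G \<and> d s u = i \<and> d s v = Suc i \<and> Suc (i + d t v) = d s t"
proof -
  \<comment> \<open>The path is traced backwards from \<open>t\<close> by predecessors;
    \<open>j\<close> is the distance left from \<open>v\<close> to \<open>t\<close>.\<close>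
  have "\<exists>u v. (u, v) \<in> parcs G \<and> d s u = d s t - Suc j \<and> d s v = d s t - j \<and> d t v = j"
    if "j < d s t" for j
    using that
  proof (induction j)
    case 0
    then obtain k where k: "d s t = Suc k"
      by (cases "d s t") auto
    obtain c where "(c, t) \<in> parcs G" "d s c = k"
      using pred_exists[OF assms(1,2) k] .
    then show ?case
      using k assms(2) by fastforce
  next
    case (Suc j)
    then obtain u v where uv: "(u, v) \<in> parcs G" "d s u = d s t - Suc j" "d t v = j"
      by (meson Suc_lessD)
    have V: "u \<in> pverts G"
      using uv wellformed' by blast
    have "d s u \<noteq> 0"
      using uv(2) Suc.prems by simp
    then obtain k where k: "d s u = Suc k"
      using not0_implies_Suc by blast
    obtain c where c: "(c, u) \<in> parcs G" "d s c = k"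
      using pred_exists[OF assms(1) V k] .
    have "d t u \<le> Suc j"
      using gdist_arc_le[OF arc_sym[OF uv(1)] assms(2)] uv(3) by simp
    moreover have "d s t \<le> d s u + d u t"
      using gdist_triangle assms V by blast
    ultimately have "d t u = Suc j"
      using uv(2) Suc.prems gdist_sym[OF assms(2) V] by simp
    then show ?case
      using c k uv(2) by (intro exI[of _ c] exI[of _ u]) auto
  qed
  from this[of "d s t - Suc i"] obtain u v where "(u, v) \<in> parcs G"
    "d s u = d s t - Suc (d s t - Suc i)" "d s v = d s t - (d s t - Suc i)" "d t v = d s t - Suc i"
    using assms(3) by auto
  then show ?thesis
    using assms(3) by (intro exI[of _ u] exI[of _ v]) auto
qed

section \<open>Separating edges\<close>

text \<open>Only the orientation leading away from \<open>s\<close> and towards \<open>t\<close> is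
  kept, so each undirected edge separating the two is counted once.\<close>

definition separating :: "'a \<Rightarrow> 'a \<Rightarrow> ('a \<times> 'a) set" where
  "separating s t = {(u, v) \<in> parcs G. d s u < d s v \<and> d t v < d t u}"

lemma finite_separating [simp]: "finite (separating s t)"
  unfolding separating_def by (rule finite_subset[OF _ pair_finite_arcs]) auto

text \<open>The last hypothesis bounds the length of a walk from \<open>s\<close> over
  \<open>(u, v)\<close> to \<open>t\<close>; comparison with \<open>d s t <= d s u + d t u\<close>
  gives \<open>d t v < d t u\<close>.\<close>

lemma separatingI:
  assumes "(u, v) \<in> parcs G" "s \<in> pverts G" "t \<in> pverts G" "d s u < d s v"
    "d s u + Suc (d t v) \<le> d s t"
  shows "(u, v) \<in> separating s t"
proof -
  have "u \<in> pverts G"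
    using assms(1) wellformed' by blast
  then have "d s t \<le> d s u + d t u"
    using gdist_triangle[of s u t] gdist_sym assms by metis
  then show ?thesis
    using assms unfolding separating_def by auto
qed

lemma level_in_separating:
  assumes "s \<in> pverts G" "t \<in> pverts G" "i < d s t"
  shows "\<exists>e \<in> separating s t. d s (fst e) = i"
proof -
  obtain u v where "(u, v) \<in> parcs G" "d s u = i" "d s v = Suc i" "Suc (i + d t v) = d s t"
    using arc_at_level[OF assms] by blast
  then show ?thesis
    using separatingI assms by (intro bexI[of _ "(u, v)"]) auto
qed

text \<open>Sending an arc to the level of its tail, the separating arcs cover all levels below
  \<open>d s t\<close>.\<close>

lemma card_separating_ge:
  assumes "s \<in> pverts G" "t \<in> pverts G"
  shows "d s t \<le> card (separating s t)"
proof -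
  have "{..<d s t} \<subseteq> (\<lambda>e. d s (fst e)) ` separating s t"
    using level_in_separating[OF assms] by blast
  then show ?thesis
    using surj_card_le[OF finite_separating] by fastforce
qed

text \<open>Each of the last two levels before \<open>t\<close> carries two separating arcs, one on
  a path through \<open>p\<close> and one on a path through \<open>q\<close>. Discarding those
  through \<open>q\<close> leaves every level covered.\<close>

lemma card_separating_two_parents:
  assumes "s \<in> pverts G" "(p, t) \<in> parcs G" "(q, t) \<in> parcs G" "p \<noteq> q"
    and lev: "d s t = Suc (d s p)" "d s q = d s p"
  shows "d s t + 2 \<le> card (separating s t)"
proof -
  have V: "p \<in> pverts G" "q \<in> pverts G" "t \<in> pverts G"
    using assms wellformed' by auto
  \<comment> \<open>Only \<open>s\<close> has level 0, so the distinct vertices \<open>p\<close> and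
    \<open>q\<close> of equal level both have predecessors; \<open>p'\<close> and \<open>q'\<close>
    may coincide.\<close>
  have "d s p \<noteq> 0"
    using gdist_eq_0_iff[OF assms(1)] V assms(4) lev(2) by metis
  then obtain k where k: "d s p = Suc k"
    using not0_implies_Suc by blast
  obtain p' where p': "(p', p) \<in> parcs G" "d s p' = k"
    using pred_exists[OF assms(1) V(1) k] .
  obtain q' where q': "(q', q) \<in> parcs G" "d s q' = k"
    using pred_exists[OF assms(1) V(2)] k lev(2) by metis
  have [simp]: "d t p = 1" "d t q = 1"
    using assms arc_sym gdist_arc by blast+
  have in_sep: "(p, t) \<in> separating s t" "(q, t) \<in> separating s t"
    "(p', p) \<in> separating s t" "(q', q) \<in> separating s t"
    using assms p' q' k V by (auto intro!: separatingI)
  \<comment> \<open>Every level is still represented after two separating arcs are removed.\<close>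
  let ?R = "{(q', q), (q, t)}"
  have "\<exists>e \<in> separating s t - ?R. d s (fst e) = i" if "i < d s t" for i
  proof -
    consider "i < k" | "i = k" | "i = Suc k"
      using \<open>i < d s t\<close> lev(1) k by linarith
    then show ?thesis
    proof cases
      case 1
      obtain e where "e \<in> separating s t" "d s (fst e) = i"
        using level_in_separating[OF assms(1) V(3) \<open>i < d s t\<close>] by blast
      moreover have "e \<notin> ?R"
        using calculation 1 q' lev k by auto
      ultimately show ?thesis by blast
    next
      case 2
      then show ?thesis
        using in_sep p' assms(4) k lev by (intro bexI[of _ "(p', p)"]) auto
    next
      case 3
      then show ?thesis
        using in_sep q' assms(4) k lev by (intro bexI[of _ "(p, t)"]) auto
    qed
  qed
  then have "{..<d s t} \<subseteq> (\<lambda>e. d s (fst e)) ` (separating s t - ?R)"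
    by blast
  then have "d s t \<le> card (separating s t - ?R)"
    using surj_card_le[of "separating s t - ?R"] by fastforce
  moreover have "card ?R = 2"
  proof -
    have "q' \<noteq> q"
      using q'(1) arc_neq by blast
    then show ?thesis by simp
  qed
  moreover have "card (separating s t - ?R) = card (separating s t) - card ?R"
    using in_sep by (intro card_Diff_subset) auto
  moreover have "card ?R \<le> card (separating s t)"
    using in_sep by (intro card_mono) auto
  ultimately show ?thesis by linarith
qed

section \<open>Double counting and the formula for eta*\<close>

definition ties :: "'a \<Rightarrow> 'a \<Rightarrow> nat" where
  "ties u v = card {w \<in> pverts G. d w u = d w v}"

text \<open>Every vertex is nearer to \<open>u\<close>, nearer to \<open>v\<close>, or equidistant.
  Hence \<open>equidist G u v\<close> is \<open>ties u v\<close> as a real number.\<close>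

lemma card_verts_split:
  "closer G u v + closer G v u + ties u v = card (pverts G)"
proof -
  have "pverts G = {w \<in> pverts G. d w u < d w v} \<union> {w \<in> pverts G. d w v < d w u}
      \<union> {w \<in> pverts G. d w u = d w v}"
    by auto
  also have "card \<dots> = closer G u v + closer G v u + ties u v"
    unfolding closer_def ties_def
    by (subst card_Un_disjoint; (subst card_Un_disjoint)?) (auto simp: pair_finite_verts)
  finally show ?thesis by simp
qed

text \<open>Both sides count triples of an arc \<open>(u, v)\<close>, a vertex \<open>s\<close>
  nearer to \<open>u\<close> and a vertex \<open>t\<close> nearer to \<open>v\<close>. For a fixed
  arc the pairs \<open>(s, t)\<close> form a product set.\<close>

lemma closer_product_sum:
  "(\<Sum>(u, v)\<in>parcs G. closer G u v * closer G v u)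
    = (\<Sum>(s, t)\<in>pverts G \<times> pverts G. card (separating s t))"
proof -
  let ?P = "\<lambda>(u, v) (s, t). d s u < d s v \<and> d t v < d t u"
  have "(\<Sum>(u, v)\<in>parcs G. closer G u v * closer G v u)
      = (\<Sum>e\<in>parcs G. card {x \<in> pverts G \<times> pverts G. ?P e x})"
  proof -
    have "closer G u v * closer G v u = card {x \<in> pverts G \<times> pverts G. ?P (u, v) x}" for u v
    proof -
      have "{x \<in> pverts G \<times> pverts G. ?P (u, v) x}
          = {w \<in> pverts G. d w u < d w v} \<times> {w \<in> pverts G. d w v < d w u}"
        by auto
      then show ?thesis
        unfolding closer_def by (simp add: card_cartesian_product)
    qed
    then show ?thesis
      by (intro sum.cong refl) (auto simp: case_prod_beta)
  qed
  also have "\<dots> = (\<Sum>x\<in>pverts G \<times> pverts G. card {e \<in> parcs G. ?P e x})"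
    unfolding card_eq_sum using pair_finite_verts pair_finite_arcs
    by (intro sum.swap_restrict) auto
  also have "\<dots> = (\<Sum>(s, t)\<in>pverts G \<times> pverts G. card (separating s t))"
    by (intro sum.cong refl) (auto simp: separating_def intro!: arg_cong[where f = card])
  finally show ?thesis .
qed

definition excess :: "'a \<Rightarrow> 'a \<Rightarrow> real" where
  "excess s t = real (card (separating s t)) - real (d s t)"

definition weight :: "'a \<Rightarrow> 'a \<Rightarrow> real" where
  "weight u v = real (ties u v) * (2 * real (card (pverts G)) - real (ties u v))"

text \<open>If x and y vertices are nearer to the two ends and t are equidistant, then n = x + y + t
  turns (x + t/2)(y + t/2) into xy + t(2n - t)/4. The sums run over ordered pairs and over arcs,
  which accounts for a further 1/2 in each.\<close>

lemma eta_star_eq: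
  "eta_star G = (\<Sum>(s, t)\<in>pverts G \<times> pverts G. excess s t) / 2
    + (\<Sum>(u, v)\<in>parcs G. weight u v) / 8"
proof -
  have eq: "(real (closer G u v) + equidist G u v / 2) * (real (closer G v u) + equidist G u v / 2)
      = real (closer G u v * closer G v u) + weight u v / 4" for u v
  proof -
    have n: "real (card (pverts G)) = real (closer G u v) + real (closer G v u) + real (ties u v)"
      using card_verts_split[of u v] by (metis of_nat_add)
    show ?thesis
      unfolding equidist_def weight_def n by (simp add: field_simps)
  qed
  have "(\<Sum>(u, v)\<in>parcs G. real (closer G u v * closer G v u))
      = real (\<Sum>(u, v)\<in>parcs G. closer G u v * closer G v u)"
    by (simp add: case_prod_beta)
  also have "\<dots> = (\<Sum>(s, t)\<in>pverts G \<times> pverts G. real (card (separating s t)))"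
    unfolding closer_product_sum by (simp add: case_prod_beta)
  finally have "revised_szeged G = (\<Sum>(s, t)\<in>pverts G \<times> pverts G. real (card (separating s t))) / 2
      + (\<Sum>(u, v)\<in>parcs G. weight u v) / 8"
    unfolding revised_szeged_def eq
    by (simp add: case_prod_beta sum.distrib sum_divide_distrib add_divide_distrib)
  moreover have "wiener G = (\<Sum>(s, t)\<in>pverts G \<times> pverts G. real (d s t)) / 2"
    unfolding wiener_def by (simp add: sum.cartesian_product)
  ultimately show ?thesis
    unfolding eta_star_def excess_def
    by (simp add: case_prod_beta sum_subtractf diff_divide_distrib)
qed

lemma excess_nonneg: "s \<in> pverts G \<Longrightarrow> t \<in> pverts G \<Longrightarrow> 0 \<le> excess s t"
  unfolding excess_def using card_separating_ge by simp

lemma separating_swap: "separating t s = prod.swap ` separating s t"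
proof -
  have "(v, u) \<in> separating s t \<longleftrightarrow> (u, v) \<in> separating t s" for u v
    unfolding separating_def using arc_sym by auto
  then show ?thesis by force
qed

lemma excess_swap:
  assumes "s \<in> pverts G" "t \<in> pverts G"
  shows "excess t s = excess s t"
proof -
  have "card (separating t s) = card (separating s t)"
    unfolding separating_swap[of t s] by (rule card_image) simp
  then show ?thesis
    unfolding excess_def using gdist_sym[OF assms] by simp
qed

lemma excess_sum_nonneg: "0 \<le> (\<Sum>(s, t)\<in>pverts G \<times> pverts G. excess s t)"
  by (intro sum_nonneg) (auto intro: excess_nonneg)

text \<open>The pair contributes at least 2 in each of its two orders.\<close>

lemma excess_sum_two_parents:
  assumes "s \<in> pverts G" "(p, t) \<in> parcs G" "(q, t) \<in> parcs G" "p \<noteq> q"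
    and lev: "d s t = Suc (d s p)" "d s q = d s p"
  shows "4 \<le> (\<Sum>(s, t)\<in>pverts G \<times> pverts G. excess s t)"
proof -
  have V: "t \<in> pverts G"
    using assms wellformed' by auto
  have "s \<noteq> t"
    using lev(1) assms(1) by auto
  have st: "2 \<le> excess s t"
    unfolding excess_def using card_separating_two_parents[OF assms] by simp
  have "4 \<le> (\<Sum>x\<in>{(s, t), (t, s)}. case x of (s, t) \<Rightarrow> excess s t)"
    using st excess_swap[OF assms(1) V] \<open>s \<noteq> t\<close> by simp
  also have "\<dots> \<le> (\<Sum>(s, t)\<in>pverts G \<times> pverts G. excess s t)"
    using assms(1) V by (intro sum_mono2) (auto intro: excess_nonneg simp: pair_finite_verts)
  finally show ?thesis .
qed

section \<open>Equidistant vertices\<close>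

lemma ties_le: "ties u v \<le> card (pverts G)"
  unfolding ties_def by (intro card_mono) (auto simp: pair_finite_verts)

lemma weight_nonneg: "0 \<le> weight u v"
  unfolding weight_def using ties_le[of u v] by simp

lemma ties_swap: "ties v u = ties u v"
  unfolding ties_def by (intro arg_cong[where f = card]) auto

lemma weight_swap: "weight v u = weight u v"
  unfolding weight_def by (simp add: ties_swap)

lemma ties_card_le:
  assumes "S \<subseteq> pverts G" "\<And>w. w \<in> S \<Longrightarrow> d w u \<noteq> d w v"
  shows "ties u v + card S \<le> card (pverts G)"
proof -
  have "ties u v + card S = card ({w \<in> pverts G. d w u = d w v} \<union> S)"
    unfolding ties_def using assms finite_subset[OF assms(1) pair_finite_verts]
    by (intro card_Un_disjoint[symmetric]) (auto simp: pair_finite_verts)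
  also have "\<dots> \<le> card (pverts G)"
    using assms(1) by (intro card_mono) (auto simp: pair_finite_verts)
  finally show ?thesis .
qed

lemma ties_arc_le:
  assumes "(u, v) \<in> parcs G"
  shows "ties u v + 2 \<le> card (pverts G)"
proof -
  have V: "u \<in> pverts G" "v \<in> pverts G"
    using assms wellformed' by auto
  have "ties u v + card {u, v} \<le> card (pverts G)"
    using V gdist_arc[OF assms] gdist_arc[OF arc_sym[OF assms]] by (intro ties_card_le) auto
  then show ?thesis
    using arc_neq[OF assms] by simp
qed

lemma ties_pos: "w \<in> pverts G \<Longrightarrow> d w u = d w v \<Longrightarrow> 1 \<le> ties u v"
  unfolding ties_def One_nat_def Suc_le_eq by (auto simp: card_gt_0_iff pair_finite_verts)

text \<open>The weight t(2n - t) is concave in t, and the lower bound is the linear function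
  agreeing with it at t = 1 and t = n - 2. The difference is (t - 1)(n - 2 - t).\<close>

lemma weight_ge:
  assumes "(u, v) \<in> parcs G" "1 \<le> ties u v"
  shows "real (ties u v) * (real (card (pverts G)) + 1) + real (card (pverts G)) - 2 \<le> weight u v"
proof -
  have "0 \<le> (real (ties u v) - 1) * (real (card (pverts G)) - 2 - real (ties u v))"
    using assms(2) ties_arc_le[OF assms(1)] by (intro mult_nonneg_nonneg) linarith+
  then show ?thesis
    unfolding weight_def by (simp add: algebra_simps)
qed

lemma ties_sum:
  "(\<Sum>(u, v)\<in>parcs G. ties u v) = (\<Sum>w\<in>pverts G. card {(u, v) \<in> parcs G. d w u = d w v})"
proof -
  have "(\<Sum>(u, v)\<in>parcs G. ties u v)
      = (\<Sum>e\<in>parcs G. card {w \<in> pverts G. d w (fst e) = d w (snd e)})"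
    unfolding ties_def by (simp add: case_prod_beta)
  also have "\<dots> = (\<Sum>w\<in>pverts G. card {e \<in> parcs G. d w (fst e) = d w (snd e)})"
    unfolding card_eq_sum using pair_finite_verts pair_finite_arcs
    by (intro sum.swap_restrict) auto
  finally show ?thesis
    by (simp add: case_prod_beta')
qed

lemma arc_levels:
  assumes "(u, v) \<in> parcs G" "w \<in> pverts G" "d w u \<noteq> d w v"
  shows "d w u = Suc (d w v) \<or> d w v = Suc (d w u)"
  using gdist_arc_le[OF assms(1,2)] gdist_arc_le[OF arc_sym[OF assms(1)] assms(2)] assms(3)
  by linarith

text \<open>Without such an arc, the distance from \<open>w\<close> changes by exactly one along
  every arc, and its parity is a 2-colouring.\<close>

lemma ex_tie_arc:
  assumes "\<not> bipartite G" "w \<in> pverts G"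
  shows "\<exists>(u, v) \<in> parcs G. d w u = d w v"
proof (rule ccontr)
  assume no: "\<not> (\<exists>(u, v) \<in> parcs G. d w u = d w v)"
  let ?X = "{x \<in> pverts G. even (d w x)}" and ?Y = "{x \<in> pverts G. odd (d w x)}"
  have "parcs G \<subseteq> ?X \<times> ?Y \<union> ?Y \<times> ?X"
  proof clarify
    fix u v
    assume uv: "(u, v) \<in> parcs G" and "\<not> (u \<in> ?Y \<and> v \<in> ?X)"
    moreover have "d w u = Suc (d w v) \<or> d w v = Suc (d w u)"
      using arc_levels[OF uv assms(2)] no uv by blast
    ultimately show "u \<in> ?X \<and> v \<in> ?Y"
      using wellformed'[OF uv] by auto
  qed
  moreover have "pverts G = ?X \<union> ?Y" "?X \<inter> ?Y = {}"
    by auto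
  ultimately show False
    using assms(1) unfolding bipartite_def by blast
qed

lemma ties_sum_ge:
  assumes "\<not> bipartite G"
  shows "2 * card (pverts G) \<le> (\<Sum>(u, v)\<in>parcs G. ties u v)"
proof -
  have "2 \<le> card {(u, v) \<in> parcs G. d w u = d w v}" if w: "w \<in> pverts G" for w
  proof -
    obtain u v where uv: "(u, v) \<in> parcs G" "d w u = d w v"
      using ex_tie_arc[OF assms w] by auto
    \<comment> \<open>A tied edge gives two tied arcs, whence the factor 2 in the bound.\<close>
    have "card {(u, v), (v, u)} \<le> card {(u, v) \<in> parcs G. d w u = d w v}"
      using uv arc_sym by (intro card_mono finite_subset[OF _ pair_finite_arcs]) auto
    then show ?thesis
      using arc_neq[OF uv(1)] by simp
  qed
  then have "(\<Sum>w\<in>pverts G. 2) \<le> (\<Sum>w\<in>pverts G. card {(u, v) \<in> parcs G. d w u = d w v})"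
    by (intro sum_mono) auto
  then show ?thesis
    unfolding ties_sum by simp
qed

text \<open>
  If \<open>w\<close> is equidistant from \<open>u\<close> and \<open>v\<close>, then \<open>u\<close>, \<open>v\<close> and their predecessors
  on shortest paths from \<open>w\<close> are four vertices that are not.
\<close>

lemma ties_le_triangle_free:
  assumes tf: "\<And>x y z. (x, y) \<in> parcs G \<Longrightarrow> (y, z) \<in> parcs G \<Longrightarrow> (z, x) \<notin> parcs G"
    and uv: "(u, v) \<in> parcs G" and pos: "1 \<le> ties u v"
  shows "ties u v + 4 \<le> card (pverts G)"
proof -
  have V: "u \<in> pverts G" "v \<in> pverts G"
    using uv wellformed' by auto
  have "{w \<in> pverts G. d w u = d w v} \<noteq> {}"
    using pos unfolding ties_def by (metis card.empty not_one_le_zero)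
  then obtain w where w: "w \<in> pverts G" "d w u = d w v"
    by blast
  have "d w u \<noteq> 0"
    using gdist_eq_0_iff w V arc_neq[OF uv] by metis
  then obtain k where k: "d w u = Suc k"
    using not0_implies_Suc by blast
  obtain p where p: "(p, u) \<in> parcs G" "d w p = k"
    using pred_exists[OF w(1) V(1) k] .
  obtain q where q: "(q, v) \<in> parcs G" "d w q = k"
    using pred_exists[OF w(1) V(2)] k w(2) by metis
  \<comment> \<open>An arc from \<open>p\<close> to \<open>v\<close> or from \<open>q\<close> to
    \<open>u\<close> would close a triangle. So \<open>p\<close> is adjacent to \<open>u\<close> but
    not to \<open>v\<close>, and \<open>q\<close> to \<open>v\<close> but not to \<open>u\<close>,
    which also rules out \<open>p = q\<close>.\<close>
  have np: "(p, v) \<notin> parcs G" "(q, u) \<notin> parcs G"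
    using tf uv p(1) q(1) arc_sym by blast+
  have pq: "p \<in> pverts G" "q \<in> pverts G"
    using p q wellformed' by auto
  have "d p u \<noteq> d p v"
    using arc_if_gdist_1[OF pq(1) V(2)] np gdist_arc[OF p(1)] by auto
  moreover have "d q u \<noteq> d q v"
    using arc_if_gdist_1[OF pq(2) V(1)] np gdist_arc[OF q(1)] by auto
  ultimately have "ties u v + card {u, v, p, q} \<le> card (pverts G)"
    using V pq gdist_arc[OF uv] gdist_arc[OF arc_sym[OF uv]] by (intro ties_card_le) auto
  moreover have "p \<noteq> q"
    using np q by blast
  then have "card {u, v, p, q} = 4"
    using arc_neq[OF uv] p q k w(2) by (auto simp: card_insert_if)
  ultimately show ?thesis by simp
qed

text \<open>The weights of the arcs sum to at least 2n(n + 4), and an eighth of this is exactly the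
  bound.\<close>

lemma eta_star_triangle_free:
  assumes "\<not> bipartite G"
    and tf: "\<And>x y z. (x, y) \<in> parcs G \<Longrightarrow> (y, z) \<in> parcs G \<Longrightarrow> (z, x) \<notin> parcs G"
  shows "real (card (pverts G)) ^ 2 / 4 + real (card (pverts G)) \<le> eta_star G"
proof -
  let ?n = "real (card (pverts G))"
  have le: "real (ties u v) * (?n + 4) \<le> weight u v" if uv: "(u, v) \<in> parcs G" for u v
  proof (cases "ties u v = 0")
    case False
    then have "ties u v + 4 \<le> card (pverts G)"
      by (intro ties_le_triangle_free tf uv) simp_all
    then have "real (ties u v) + 4 \<le> ?n"
      by linarith
    then show ?thesis
      unfolding weight_def by (intro mult_left_mono) auto
  qed (simp add: weight_def)
  have "2 * ?n * (?n + 4) \<le> real (\<Sum>(u, v)\<in>parcs G. ties u v) * (?n + 4)"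
    using ties_sum_ge[OF assms(1)] by (intro mult_right_mono) linarith+
  also have "\<dots> = (\<Sum>(u, v)\<in>parcs G. real (ties u v) * (?n + 4))"
    by (simp add: case_prod_beta sum_distrib_right)
  also have "\<dots> \<le> (\<Sum>(u, v)\<in>parcs G. weight u v)"
    using le by (intro sum_mono) auto
  finally show ?thesis
    unfolding eta_star_eq using excess_sum_nonneg by (simp add: power2_eq_square field_simps)
qed

end

section \<open>Graphs with a triangle\<close>

locale connected_graph_with_triangle = connected_pair_graph +
  fixes a b c :: 'a
  assumes ab: "(a, b) \<in> parcs G" and bc: "(b, c) \<in> parcs G" and ca: "(c, a) \<in> parcs G"
begin

lemma triangle_neq [simp]: "a \<noteq> b" "b \<noteq> c" "c \<noteq> a" "b \<noteq> a" "c \<noteq> b" "a \<noteq> c"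
  using ab bc ca arc_neq by blast+

lemma triangle_verts [simp]: "a \<in> pverts G" "b \<in> pverts G" "c \<in> pverts G"
  using ab bc ca wellformed' by blast+

lemma triangle_arcs: "x \<in> {a, b, c} \<Longrightarrow> y \<in> {a, b, c} \<Longrightarrow> x \<noteq> y \<Longrightarrow> (x, y) \<in> parcs G"
  using ab bc ca arc_sym by auto

lemma triangle_ties_pos: "1 \<le> ties a b" "1 \<le> ties b c" "1 \<le> ties c a"
proof -
  have "d c a = d c b" "d a b = d a c" "d b c = d b a"
    by (simp_all add: gdist_arc triangle_arcs)
  then show "1 \<le> ties a b" "1 \<le> ties b c" "1 \<le> ties c a"
    using ties_pos triangle_verts by blast+
qed

text \<open>The distances from a vertex to the three corners differ pairwise by at most one, so two
  of them agree.\<close>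

lemma triangle_ties_sum: "card (pverts G) \<le> ties a b + ties b c + ties c a"
proof -
  let ?S = "\<lambda>u v. {w \<in> pverts G. d w u = d w v}"
  have "w \<in> ?S a b \<union> ?S b c \<union> ?S c a" if w: "w \<in> pverts G" for w
    using w arc_levels[OF ab w] arc_levels[OF bc w] arc_levels[OF ca w] by auto
  then have "card (pverts G) \<le> card (?S a b \<union> ?S b c \<union> ?S c a)"
    using pair_finite_verts by (intro card_mono) auto
  also have "\<dots> \<le> card (?S a b) + card (?S b c) + card (?S c a)"
    using card_Un_le[of "?S a b \<union> ?S b c" "?S c a"] card_Un_le[of "?S a b" "?S b c"] by linarith
  finally show ?thesis
    unfolding ties_def .
qed

text \<open>Adding \<open>weight_ge\<close> over the three sides gives at least n(n + 1) + 3(n -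
  2).\<close>

lemma triangle_weight_sum:
  "real (card (pverts G)) ^ 2 + 4 * real (card (pverts G)) - 6 \<le> weight a b + weight b c + weight c a"
proof -
  let ?n = "real (card (pverts G))"
  have "?n * (?n + 1) \<le> (real (ties a b) + real (ties b c) + real (ties c a)) * (?n + 1)"
    using triangle_ties_sum by (intro mult_right_mono) linarith+
  then show ?thesis
    using weight_ge[OF ab] weight_ge[OF bc] weight_ge[OF ca] triangle_ties_pos
    by (simp add: power2_eq_square algebra_simps)
qed

definition triangle_arc_set :: "('a \<times> 'a) set" where
  "triangle_arc_set = {(a, b), (b, a), (b, c), (c, b), (c, a), (a, c)}"

lemma triangle_arc_set_subset: "triangle_arc_set \<subseteq> parcs G"
  unfolding triangle_arc_set_def using triangle_arcs by auto

lemma weight_sum_triangle_arc_set: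
  "(\<Sum>(u, v)\<in>triangle_arc_set. weight u v) = 2 * (weight a b + weight b c + weight c a)"
  unfolding triangle_arc_set_def using weight_swap[of b a] weight_swap[of c b] weight_swap[of a c]
  by simp

lemma weight_sum_mono:
  assumes "S \<subseteq> parcs G"
  shows "(\<Sum>(u, v)\<in>S. weight u v) \<le> (\<Sum>(u, v)\<in>parcs G. weight u v)"
  using assms by (intro sum_mono2) (auto simp: pair_finite_arcs weight_nonneg)

text \<open>The triangle alone falls short of the bound by at most 6/4 = 3/2, and the excess adds at
  least 4/2 = 2.\<close>

lemma eta_star_two_parents:
  assumes "s \<in> pverts G" "(p, t) \<in> parcs G" "(q, t) \<in> parcs G" "p \<noteq> q"
    and "d s t = Suc (d s p)" "d s q = d s p"
  shows "real (card (pverts G)) ^ 2 / 4 + real (card (pverts G)) \<le> eta_star G"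
  using excess_sum_two_parents[OF assms] weight_sum_mono[OF triangle_arc_set_subset]
    triangle_weight_sum
  unfolding eta_star_eq weight_sum_triangle_arc_set by simp

text \<open>An end outside the triangle forces n >= 4, so the two arcs of the tied edge add at least
  2(2n - 1)/8 >= 7/4, more than the missing 3/2.\<close>

lemma eta_star_further_tie:
  assumes uv: "(u, v) \<in> parcs G" "u \<notin> {a, b, c} \<or> v \<notin> {a, b, c}"
    and w: "w \<in> pverts G" "d w u = d w v"
  shows "real (card (pverts G)) ^ 2 / 4 + real (card (pverts G)) \<le> eta_star G"
proof -
  let ?n = "real (card (pverts G))"
  obtain x where "x \<in> pverts G" "x \<notin> {a, b, c}"
    using uv wellformed' by blast
  then have "card {a, b, c, x} \<le> card (pverts G)"
    by (intro card_mono pair_finite_verts) auto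
  moreover have "card {a, b, c, x} = 4"
    using \<open>x \<notin> {a, b, c}\<close> by (auto simp: card_insert_if)
  ultimately have n: "4 \<le> ?n" by simp
  have pos: "1 \<le> ties u v"
    using ties_pos[OF w] .
  have "?n + 1 \<le> real (ties u v) * (?n + 1)"
    using pos by (intro mult_le_cancel_right1[THEN iffD2]) auto
  then have uv_weight: "2 * ?n - 1 \<le> weight u v"
    using weight_ge[OF uv(1) pos] by linarith
  have disj: "triangle_arc_set \<inter> {(u, v), (v, u)} = {}"
    using uv(2) unfolding triangle_arc_set_def by auto
  have "(\<Sum>(u, v)\<in>triangle_arc_set. weight u v) + (\<Sum>(u, v)\<in>{(u, v), (v, u)}. weight u v)
      = (\<Sum>(u, v)\<in>triangle_arc_set \<union> {(u, v), (v, u)}. weight u v)"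
    using finite_subset[OF triangle_arc_set_subset pair_finite_arcs] disj
    by (intro sum.union_disjoint[symmetric]) simp_all
  also have "\<dots> \<le> (\<Sum>(u, v)\<in>parcs G. weight u v)"
    using uv arc_sym triangle_arc_set_subset by (intro weight_sum_mono) auto
  finally have "(\<Sum>(u, v)\<in>triangle_arc_set. weight u v) + 2 * weight u v
      \<le> (\<Sum>(u, v)\<in>parcs G. weight u v)"
    using arc_neq[OF uv(1)] weight_swap[of v u] by simp
  then show ?thesis
    using uv_weight n excess_sum_nonneg triangle_weight_sum
    unfolding eta_star_eq weight_sum_triangle_arc_set by simp
qed

text \<open>The corner \<open>a\<close> stands for the contracted triangle, which keeps the vertex
  type. Several edges from one outer vertex to the triangle would be merged;
  \<open>triangle_nbr_unique\<close> excludes this in the case of interest.\<close>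

definition contraction :: "'a pair_pre_digraph" where
  "contraction = \<lparr>pverts = pverts G - {b, c},
    parcs = {(x, y) \<in> parcs G. x \<notin> {a, b, c} \<and> y \<notin> {a, b, c}}
      \<union> {(x, a) | x. x \<notin> {a, b, c} \<and> (\<exists>y\<in>{a, b, c}. (x, y) \<in> parcs G)}
      \<union> {(a, x) | x. x \<notin> {a, b, c} \<and> (\<exists>y\<in>{a, b, c}. (x, y) \<in> parcs G)}\<rparr>"

lemma pverts_contraction: "pverts contraction = pverts G - {b, c}"
  unfolding contraction_def by simp

lemma arc_contraction_iff:
  "(x, y) \<in> parcs contraction \<longleftrightarrow>
    (x, y) \<in> parcs G \<and> x \<notin> {a, b, c} \<and> y \<notin> {a, b, c} \<or>
    y = a \<and> x \<notin> {a, b, c} \<and> (\<exists>z\<in>{a, b, c}. (x, z) \<in> parcs G) \<or>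
    x = a \<and> y \<notin> {a, b, c} \<and> (\<exists>z\<in>{a, b, c}. (y, z) \<in> parcs G)"
  unfolding contraction_def by auto

lemma pair_graph_contraction: "pair_graph contraction"
proof unfold_locales
  show "finite (pverts contraction)"
    by (simp add: pverts_contraction pair_finite_verts)
  have "parcs contraction \<subseteq> pverts G \<times> pverts G"
    using wellformed' by (auto simp: arc_contraction_iff)
  then show "finite (parcs contraction)"
    by (rule finite_subset) (simp add: pair_finite_verts)
  show "symmetric (with_proj contraction)"
    unfolding symmetric_def sym_def by (auto simp: arc_contraction_iff dest: arc_sym)
next
  fix e
  assume e: "e \<in> parcs contraction"
  obtain x y where [simp]: "e = (x, y)"
    by (cases e)
  have "(x, y) \<in> parcs contraction"
    using e by simp
  then show "fst e \<in> pverts contraction" "snd e \<in> pverts contraction" "fst e \<noteq> snd e"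
    unfolding arc_contraction_iff pverts_contraction using wellformed' arc_neq by fastforce+
qed

section \<open>Unique breadth-first parents make the contraction a tree\<close>

context
  assumes levels: "\<And>u v. (u, v) \<in> parcs G \<Longrightarrow> u \<notin> {a, b, c} \<or> v \<notin> {a, b, c} \<Longrightarrow> d a u \<noteq> d a v"
    and unique_parent: "\<And>p q t. (p, t) \<in> parcs G \<Longrightarrow> (q, t) \<in> parcs G \<Longrightarrow>
      d a t = Suc (d a p) \<Longrightarrow> d a q = d a p \<Longrightarrow> p = q"
begin

lemma parent_if_le:
  assumes "(x, y) \<in> parcs G" "x \<notin> {a, b, c} \<or> y \<notin> {a, b, c}" "d a y \<le> d a x"
  shows "d a x = Suc (d a y)"
  using arc_levels[OF assms(1), of a] levels[OF assms(1,2)] assms(3) by auto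

text \<open>Corners have level at most 1 and outer vertices level at least 1, so
  \<open>parent_if_le\<close> applies.\<close>

lemma triangle_nbr_is_parent:
  assumes "(x, y) \<in> parcs G" "x \<notin> {a, b, c}" "y \<in> {a, b, c}"
  shows "d a x = Suc (d a y)"
proof (rule parent_if_le)
  have "d a y \<le> 1"
    using assms(3) gdist_arc triangle_arcs by (cases "y = a") (auto simp: le_Suc_eq)
  moreover have "d a x \<noteq> 0"
    using gdist_eq_0_iff[of a x] wellformed'[OF assms(1)] assms(2) by auto
  ultimately show "d a y \<le> d a x" by simp
qed (use assms in auto)

text \<open>Both corners are parents of \<open>x\<close>. This makes the attachment map of the
  expansion well defined.\<close>

lemma triangle_nbr_unique:
  assumes "x \<notin> {a, b, c}" "(x, y) \<in> parcs G" "(x, z) \<in> parcs G" "y \<in> {a, b, c}"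
    "z \<in> {a, b, c}"
  shows "y = z"
  using unique_parent[of y x z] triangle_nbr_is_parent[of x y] triangle_nbr_is_parent[of x z]
    assms arc_sym by auto

text \<open>A neighbour in the contraction that is not above \<open>x\<close> comes from a parent of
  \<open>x\<close> in \<open>G\<close>, either itself or a corner collapsed to \<open>a\<close>.
  Levels are always distances in \<open>G\<close>, not in the contraction.\<close>

lemma contraction_nbr:
  assumes "(x, y) \<in> parcs contraction" "d a y \<le> d a x"
  shows "x \<notin> {a, b, c} \<and> (\<exists>z. (x, z) \<in> parcs G \<and> d a x = Suc (d a z) \<and>
    (if z \<in> {a, b, c} then y = a else y = z))"
proof -
  have "x \<noteq> a"
  proof
    assume "x = a"
    then have "y \<in> pverts G" "y \<noteq> a"
      using assms(1) wellformed' by (auto simp: arc_contraction_iff)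
    then show False
      using \<open>x = a\<close> assms(2) gdist_eq_0_iff[of a y] by simp
  qed
  then have x: "x \<notin> {a, b, c}"
    using assms(1) by (auto simp: arc_contraction_iff)
  from assms(1) \<open>x \<noteq> a\<close> consider (arc) "(x, y) \<in> parcs G" "y \<notin> {a, b, c}"
    | (nbr) z where "z \<in> {a, b, c}" "(x, z) \<in> parcs G" "y = a"
    by (auto simp: arc_contraction_iff)
  then show ?thesis
  proof cases
    case arc
    then show ?thesis
      using x parent_if_le assms(2) by auto
  next
    case nbr
    then show ?thesis
      using x triangle_nbr_is_parent[of x z] by (intro conjI exI[of _ z]) simp_all
  qed
qed

text \<open>Descend to a parent in \<open>G\<close> until the parent is a corner; that last step
  becomes an arc to \<open>a\<close>.\<close>

lemma contraction_reachable:
  assumes "x \<in> pverts contraction"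
  shows "x \<rightarrow>\<^sup>*\<^bsub>with_proj contraction\<^esub> a"
  using assms
proof (induction "d a x" arbitrary: x rule: less_induct)
  case less
  interpret C: pair_graph contraction
    by (rule pair_graph_contraction)
  show ?case
  proof (cases "x = a")
    case True
    then show ?thesis
      using less.prems by (simp add: C.reachable_refl)
  next
    case False
    then have x: "x \<in> pverts G" "x \<notin> {a, b, c}"
      using less.prems by (auto simp: pverts_contraction)
    then have "d a x \<noteq> 0"
      using gdist_eq_0_iff[of a x] by auto
    then obtain k where k: "d a x = Suc k"
      using not0_implies_Suc by blast
    obtain y where y: "(y, x) \<in> parcs G" "d a y = k"
      using pred_exists[OF triangle_verts(1) x(1) k] .
    show ?thesis
    proof (cases "y \<in> {a, b, c}")
      case True
      then have "(x, a) \<in> parcs contraction"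
        using x y arc_sym by (auto simp: arc_contraction_iff)
      then show ?thesis
        by (intro C.reachable_adjI) simp
    next
      case False
      then have arc: "(x, y) \<in> parcs contraction"
        using x y arc_sym by (auto simp: arc_contraction_iff)
      then have "y \<rightarrow>\<^sup>*\<^bsub>with_proj contraction\<^esub> a"
        using less.hyps y k C.wellformed' by simp
      then show ?thesis
        using arc by (intro C.adj_reachable_trans[of x y]) simp_all
    qed
  qed
qed

lemma undirected_tree_contraction: "undirected_tree contraction"
proof -
  interpret C: pair_graph contraction
    by (rule pair_graph_contraction)
  have reach: "x \<rightarrow>\<^sup>*\<^bsub>mk_symmetric (with_proj contraction)\<^esub> y"
    if "x \<in> pverts contraction" "y \<in> pverts contraction" for x y
  proof -
    have "a \<rightarrow>\<^sup>*\<^bsub>with_proj contraction\<^esub> y"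
      using contraction_reachable[OF that(2)] by (rule C.symmetric_reachable')
    with contraction_reachable[OF that(1)] have "x \<rightarrow>\<^sup>*\<^bsub>with_proj contraction\<^esub> y"
      by (rule C.reachable_trans)
    then show ?thesis
      by (rule C.reachable_mk_symmetricI)
  qed
  have "a \<in> pverts contraction"
    by (simp add: pverts_contraction)
  then have conn: "Digraph_Component.connected (with_proj contraction)"
    unfolding Digraph_Component.connected_def strongly_connected_def using reach by auto
  \<comment> \<open>\<open>d a\<close> serves as the level function: by
    \<open>contraction_nbr\<close>, both neighbours of \<open>y\<close> come from a parent of
    \<open>y\<close>, and there is only one.\<close>
  have "length p < 3" if "pre_digraph.cycle (with_proj contraction) p" for p
  proof (rule cycle_length_less_3[OF _ that])
    fix x y z
    assume xy: "(x, y) \<in> parcs contraction" and yz: "(y, z) \<in> parcs contraction"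
      and le: "d a x \<le> d a y" "d a z \<le> d a y"
    have yx: "(y, x) \<in> parcs contraction"
      using C.arcs_symmetric xy by blast
    obtain x' where x': "(y, x') \<in> parcs G" "d a y = Suc (d a x')"
      "if x' \<in> {a, b, c} then x = a else x = x'"
      using contraction_nbr[OF yx le(1)] by blast
    obtain z' where z': "(y, z') \<in> parcs G" "d a y = Suc (d a z')"
      "if z' \<in> {a, b, c} then z = a else z = z'"
      using contraction_nbr[OF yz le(2)] by blast
    have "x' = z'"
      using unique_parent[of x' y z'] x' z' arc_sym by simp
    then show "x = z"
      using x'(3) z'(3) by (simp split: if_splits)
  qed
  then show ?thesis
    unfolding undirected_tree_def using pair_graph_contraction conn by fastforce
qed

lemma triangle_expansion_contraction: "triangle_expansion contraction a G"
proof -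
  \<comment> \<open>\<open>f\<close> sends an outer vertex next to the triangle to its only
    neighbour there; it is evaluated meaningfully only at neighbours of \<open>a\<close>.\<close>
  define f where "f x = (THE y. y \<in> {a, b, c} \<and> (x, y) \<in> parcs G)" for x
  have f: "f x = y" if "x \<notin> {a, b, c}" "(x, y) \<in> parcs G" "y \<in> {a, b, c}" for x y
    unfolding f_def using that triangle_nbr_unique by (intro the_equality) blast+
  have nbr: "(x, a) \<in> parcs contraction \<longleftrightarrow>
      x \<notin> {a, b, c} \<and> (\<exists>y\<in>{a, b, c}. (x, y) \<in> parcs G)" for x
    by (auto simp: arc_contraction_iff)
  have fx: "f x \<in> {a, b, c} \<and> (x, f x) \<in> parcs G" if "(x, a) \<in> parcs contraction" for x
    using that f unfolding nbr by metis
  \<comment> \<open>The four kinds of arcs correspond to which of the two ends lie on the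
    triangle.\<close>
  have arc_iff: "(x, y) \<in> parcs G \<longleftrightarrow>
      (x, y) \<in> parcs contraction \<and> x \<noteq> a \<and> y \<noteq> a \<or>
      x \<in> {a, b, c} \<and> y \<in> {a, b, c} \<and> x \<noteq> y \<or>
      (x, a) \<in> parcs contraction \<and> y = f x \<or> (y, a) \<in> parcs contraction \<and> x = f y"
    (is "?L \<longleftrightarrow> ?R") for x y
  proof
    assume L: ?L
    consider "x \<in> {a, b, c}" "y \<in> {a, b, c}" | "x \<notin> {a, b, c}" "y \<in> {a, b, c}"
      | "x \<in> {a, b, c}" "y \<notin> {a, b, c}" | "x \<notin> {a, b, c}" "y \<notin> {a, b, c}"
      by blast
    then show ?R
    proof cases
      case 1
      then show ?thesis
        using arc_neq[OF L] by blast
    next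
      case 2
      then show ?thesis
        using L f[of x y] nbr by blast
    next
      case 3
      then show ?thesis
        using arc_sym[OF L] f[of y x] nbr by blast
    next
      case 4
      then show ?thesis
        using L by (auto simp: arc_contraction_iff)
    qed
  next
    assume ?R
    then show ?L
      using triangle_arcs[of x y] fx arc_sym by (auto simp: arc_contraction_iff)
  qed
  let ?A = "{(x, y). (x, y) \<in> parcs contraction \<and> x \<noteq> a \<and> y \<noteq> a} \<union>
      {(x, y). x \<in> {a, b, c} \<and> y \<in> {a, b, c} \<and> x \<noteq> y} \<union>
      {(x, f x) | x. (x, a) \<in> parcs contraction} \<union>
      {(f x, x) | x. (x, a) \<in> parcs contraction}"
  have mem_iff: "(x, y) \<in> ?A \<longleftrightarrow>
      (x, y) \<in> parcs contraction \<and> x \<noteq> a \<and> y \<noteq> a \<or>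
      x \<in> {a, b, c} \<and> y \<in> {a, b, c} \<and> x \<noteq> y \<or>
      (x, a) \<in> parcs contraction \<and> y = f x \<or> (y, a) \<in> parcs contraction \<and> x = f y" for x y
    by auto
  have "parcs G = ?A"
  proof (rule set_eqI)
    fix e :: "'a \<times> 'a"
    obtain x y where "e = (x, y)"
      by (cases e)
    then show "e \<in> parcs G \<longleftrightarrow> e \<in> ?A"
      by (simp only: arc_iff mem_iff)
  qed
  moreover have "pverts G = (pverts contraction - {a}) \<union> {a, b, c}"
    by (auto simp: pverts_contraction)
  moreover have "{a, b, c} \<inter> (pverts contraction - {a}) = {}"
    by (auto simp: pverts_contraction)
  moreover have "\<forall>x. (x, a) \<in> parcs contraction \<longrightarrow> f x \<in> {a, b, c}"
    using fx by blast
  moreover have "distinct [a, b, c]"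
    by simp
  ultimately show ?thesis
    unfolding triangle_expansion_def by blast
qed

lemma tree_expanded: "tree_expanded_by_triangle G"
  unfolding tree_expanded_by_triangle_def
  using undirected_tree_contraction triangle_expansion_contraction
  by (intro exI[of _ contraction] exI[of _ a]) (simp add: pverts_contraction)

end

text \<open>If the bound failed, there would be neither a further tied edge nor a vertex with two
  parents, so levels from \<open>a\<close> would satisfy both assumptions of
  \<open>tree_expanded\<close>.\<close>

lemma eta_star_triangle:
  assumes "\<not> tree_expanded_by_triangle G"
  shows "real (card (pverts G)) ^ 2 / 4 + real (card (pverts G)) \<le> eta_star G"
proof (rule ccontr)
  assume no: "\<not> ?thesis"
  have "tree_expanded_by_triangle G"
  proof (rule tree_expanded)
    show "d a u \<noteq> d a v" if "(u, v) \<in> parcs G" "u \<notin> {a, b, c} \<or> v \<notin> {a, b, c}" for u v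
      using no eta_star_further_tie[OF that triangle_verts(1)] by blast
    show "p = q" if "(p, t) \<in> parcs G" "(q, t) \<in> parcs G" "d a t = Suc (d a p)" "d a q = d a p"
      for p q t
      using no eta_star_two_parents[OF triangle_verts(1) that(1,2) _ that(3,4)] by blast
  qed
  then show False
    using assms by blast
qed

end

theorem theorem21:
  fixes G :: "'a pair_pre_digraph" and n :: nat
  assumes "pair_graph G"
    and "Digraph_Component.connected (with_proj G)"
    and "card (pverts G) = n"
    and "\<not> bipartite G"
    and "\<not> tree_expanded_by_triangle G"
  shows "eta_star G \<ge> real n ^ 2 / 4 + real n"
proof -
  interpret connected_pair_graph G
    using assms(1,2) by (simp add: connected_pair_graph_def connected_pair_graph_axioms_def)
  show ?thesis
  \<comment> \<open>A triangle supplies the ties by itself; without one they come from odd cycles,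
    through the failure of bipartiteness.\<close>
  proof (cases "\<exists>x y z. (x, y) \<in> parcs G \<and> (y, z) \<in> parcs G \<and> (z, x) \<in> parcs G")
    case True
    then obtain x y z where "(x, y) \<in> parcs G" "(y, z) \<in> parcs G" "(z, x) \<in> parcs G"
      by blast
    then interpret connected_graph_with_triangle G x y z
      by unfold_locales
    show ?thesis
      using eta_star_triangle[OF assms(5)] assms(3) by simp
  next
    case False
    then show ?thesis
      using eta_star_triangle_free[OF assms(4)] assms(3) by blast
  qed
qed

end
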